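(* Let $n\ge 1$. Suppose $f:\mathbb{R}^n\to\mathbb{R}$ is an admissible function, is not identically zero, and satisfies the following two conditions: (1) $f(x)\le 0$ for all $x\in\mathbb{R}^n$ with $|x|\ge 1$, and (2) $\widehat f(t)\ge 0$ for all $t\in\mathbb{R}^n$. Then the center density of every sphere packing in $\mathbb{R}^n$ is bounded above by $$\frac{f(0)}{2^n\,\widehat f(0)},$$ where $f(0)/\widehat f(0)$ is interpreted as $+\infty$ if $\widehat f(0)=0$.
   Context: Fourier transform: for $f\in L^1(\mathbb{R}^n)$, $\widehat f(t)=\int_{\mathbb{R}^n} f(x)e^{2\pi i\langle x,t\rangle}\,dx$. A function $f:\mathbb{R}^n\to\mathbb{R}$ is admissible if it is continuous and there are constants $\delta>0$ and $C>0$ such that $|f(x)|\le C(1+|x|)^{-n-\delta}$ and $|\widehat f(x)|\le C(1+|x|)^{-n-\delta}$ for all $x\in\mathbb{R}^n$. A sphere packing in $\mathbb{R}^n$ is a collection $\mathcal P$ of congruent closed balls (of positive radius) that do not intersect except along their boundaries. Its density $\Delta$ is the fraction of space covered by the balls, taken in general to be the upper density $$\Delta=\limsup_{r\to\infty}\ \sup_{p\in\mathbb{R}^n}\frac{\operatorname{vol}(B(p,r)\cap\mathcal P)}{\operatorname{vol}B(p,r)},$$ where $B(p,r)$ is the ball of radius $r$ centered at $p$ and $B(p,r)\cap\mathcal P$ denotes the part of $B(p,r)$ covered by the balls of $\mathcal P$. The center density $\delta$ of the packing is defined by $\Delta=\frac{\pi^{n/2}}{(n/2)!}\,\delta$ (the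 number of sphere centers per unit volume when the packing is scaled to use unit spheres), where $(n/2)!$ means $\Gamma(n/2+1)$. *)

theory Defs
  imports "HOL-Analysis.Analysis"
begin

definition fourier :: "(real ^ 'n \<Rightarrow> real) \<Rightarrow> real ^ 'n \<Rightarrow> complex" where
  "fourier f t =
     (LINT x|lborel. complex_of_real (f x) * exp (2 * pi * \<i> * complex_of_real (x \<bullet> t)))"

text \<open>
  Integrability of \<open>f\<close> is not listed separately: it follows from continuity and the decay bound.
\<close>
definition admissible :: "(real ^ 'n \<Rightarrow> real) \<Rightarrow> bool" where
  "admissible f \<longleftrightarrow>
     continuous_on UNIV f \<and>
     (\<exists>\<delta>>0. \<exists>C>0. \<forall>x.
        \<bar>f x\<bar> \<le> C * (1 + norm x) powr (- real CARD('n) - \<delta>) \<and>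
        cmod (fourier f x) \<le> C * (1 + norm x) powr (- real CARD('n) - \<delta>))"

text \<open>
  A packing is the set of its balls, not of their centers.
\<close>
definition sphere_packing :: "(real ^ 'n) set set \<Rightarrow> bool" where
  "sphere_packing P \<longleftrightarrow>
     (\<exists>r>0. \<forall>B\<in>P. \<exists>c. B = cball c r) \<and>
     pairwise (\<lambda>A B. A \<inter> B \<subseteq> frontier A \<inter> frontier B) P"

definition upper_density :: "(real ^ 'n) set set \<Rightarrow> ereal" where
  "upper_density P =
     Limsup at_top (\<lambda>r::real. SUP p.
       ereal (measure lborel (cball p r \<inter> \<Union>P) / measure lborel (cball p r)))"

text \<open>
  The divisor is the volume \<open>\<pi>\<^sup>n\<^sup>/\<^sup>2 / (n/2)!\<close> of the unit ball,
  where \<open>(n/2)! = \<Gamma>(n/2 + 1)\<close>.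
\<close>
definition center_density :: "(real ^ 'n) set set \<Rightarrow> ereal" where
  "center_density P =
     upper_density P /
       ereal (pi powr (real CARD('n) / 2) / Gamma (real CARD('n) / 2 + 1))"

end

theory Submission
  imports Defs "HOL-Probability.Characteristic_Functions" "HOL-Real_Asymp.Real_Asymp"
begin

text \<open>
  Scale the packing so that the centers have mutual distances at least 1. Instead of applying Poisson
  summation to periodic packings, the proof bounds the number \<open>N\<close> of centers in a ball of radius \<open>T\<close>
  directly, by positive definiteness of \<open>f\<close>.

  By Fourier inversion (\<open>fourier_inversion\<close>) \<open>f\<close> is the inverse Fourier transform of a nonnegative integrable
  function. Hence for all finite Borel measures \<open>\<mu>\<close>, \<open>\<nu>\<close> the double integral of \<open>f (x - y)\<close> against
  \<open>\<mu> - \<nu>\<close> in both variables is nonnegative (\<open>energy_nonneg\<close>). Take for \<open>\<mu>\<close> the sum of the point masses at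
  the \<open>N\<close> centers, and for \<open>\<nu>\<close> Lebesgue measure on the concentric ball of radius \<open>T + L\<close> with volume \<open>v\<close>,
  normalized to total mass \<open>N\<close>. Since \<open>f (x - y) \<le> 0\<close> for distinct centers, the \<open>\<mu>\<mu>\<close>-term is at most
  \<open>N f(0)\<close>. Let \<open>I\<close> be the integral of \<open>f\<close>, which is the value at 0 of its Fourier transform. Each of the
  other two double integrals is close to \<open>N\<^sup>2 I / v\<close>: the errors come from the tail of \<open>f\<close> outside the
  ball of radius \<open>L\<close> and from the shell between the two balls. So, up to these errors,
  \<open>0 \<le> N f(0) - N\<^sup>2 I / v\<close>, that is \<open>N / v \<le> f(0) / I\<close> (\<open>separated_card_bound\<close>).

  The shell becomes negligible as \<open>T\<close> tends to infinity with \<open>L\<close> fixed, uniformly in the position of the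
  ball, and the tail as \<open>L\<close> tends to infinity. Undoing the scaling gives the factor \<open>1 / 2\<^sup>n\<close>.
\<close>

section \<open>Product and affine formulas for Lebesgue measure\<close>

lemma
  fixes g :: "'a::euclidean_space \<Rightarrow> real \<Rightarrow> 'b::{real_normed_field,banach,second_countable_topology}"
  assumes g: "\<And>b. b \<in> Basis \<Longrightarrow> integrable lborel (g b)"
  shows integrable_lborel_prod: "integrable lborel (\<lambda>x. \<Prod>b\<in>Basis. g b (x \<bullet> b))" (is ?I)
    and integral_lborel_prod:
      "(LINT x|lborel. (\<Prod>b\<in>Basis. g b (x \<bullet> b))) = (\<Prod>b\<in>Basis. LINT y|lborel. g b y)" (is ?E)
proof -
  interpret product_sigma_finite "\<lambda>_::'a. lborel :: real measure" ..
  have meas [measurable]: "(\<lambda>x. \<Prod>b\<in>Basis. g b (x \<bullet> b)) \<in> borel_measurable borel"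
  proof (rule borel_measurable_prod)
    fix b :: 'a assume "b \<in> Basis"
    then have [measurable]: "g b \<in> borel_measurable borel" using g by (auto dest: borel_measurable_integrable)
    show "(\<lambda>x. g b (x \<bullet> b)) \<in> borel_measurable borel" by measurable
  qed
  have T: "(\<lambda>x. \<Sum>b\<in>Basis. x b *\<^sub>R b) \<in> measurable (\<Pi>\<^sub>M b\<in>Basis. lborel) (borel :: 'a measure)"
    by measurable
  have comp: "(\<Prod>c\<in>Basis. g c ((\<Sum>b\<in>Basis. x b *\<^sub>R b) \<bullet> c)) = (\<Prod>c\<in>Basis. g c (x c))" for x
    by (rule prod.cong) auto
  show ?I
    by (subst lborel_eq, subst integrable_distr_eq[OF T])
       (simp_all add: comp product_integrable_prod g)
  show ?E
    by (subst lborel_eq, subst integral_distr[OF T])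
       (simp_all add: comp product_integral_prod g)
qed

lemma
  fixes f :: "'a::euclidean_space \<Rightarrow> 'b::{banach, second_countable_topology}"
  assumes [measurable]: "f \<in> borel_measurable borel" and c: "c \<noteq> 0"
  shows integral_lborel_affine:
      "(LINT x|lborel. f x) = \<bar>c\<bar> ^ DIM('a) *\<^sub>R (LINT x|lborel. f (t + c *\<^sub>R x))"
    and integrable_lborel_affine:
      "integrable lborel f \<Longrightarrow> integrable lborel (\<lambda>x. f (t + c *\<^sub>R x))"
proof -
  show "(LINT x|lborel. f x) = \<bar>c\<bar> ^ DIM('a) *\<^sub>R (LINT x|lborel. f (t + c *\<^sub>R x))"
    by (subst lborel_affine[OF c, of t]) (simp add: integral_density integral_distr)
  assume "integrable lborel f"
  then have "integrable lborel (\<lambda>x. \<bar>c\<bar> ^ DIM('a) *\<^sub>R f (t + c *\<^sub>R x))"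
    by (subst (asm) lborel_affine[OF c, of t]) (simp add: integrable_density integrable_distr_eq)
  then show "integrable lborel (\<lambda>x. f (t + c *\<^sub>R x))"
    using c integrable_scaleR_right[of "1 / \<bar>c\<bar> ^ DIM('a)" lborel] by fastforce
qed

lemma integrable_one_plus_abs_powr:
  fixes d :: real
  assumes "d > 0"
  shows "integrable lborel (\<lambda>x::real. (1 + \<bar>x\<bar>) powr (-1 - d))"
proof -
  let ?h = "\<lambda>x::real. indicator {0..} x * (1 + x) powr (-1 - d)"
  have m: "(\<lambda>x::real. (1 + x) powr (-1 - d)) \<in> borel_measurable borel" by measurable
  have "(\<integral>\<^sup>+x. ennreal ((1 + x) powr (-1 - d)) * indicator {0..} x \<partial>lborel)
      = ennreal (0 - (- (1 / d) * (1 + 0) powr (-d)))"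
  proof (rule nn_integral_FTC_atLeast[where F = "\<lambda>x. - (1 / d) * (1 + x) powr (-d)"])
    fix x :: real assume "0 \<le> x"
    then show "((\<lambda>x. - (1 / d) * (1 + x) powr (-d)) has_real_derivative (1 + x) powr (-1 - d)) (at x)"
      using assms by (auto intro!: derivative_eq_intros simp: minus_diff_commute)
  next
    have "((\<lambda>x::real. (1 + x) powr (-d)) \<longlongrightarrow> 0) at_top"
      using assms by real_asymp
    from tendsto_mult_left[OF this, of "- (1/d)"]
    show "((\<lambda>x. - (1 / d) * (1 + x) powr (-d)) \<longlongrightarrow> 0) at_top" by simp
  qed (use m in auto)
  then have "(\<integral>\<^sup>+x. ennreal (norm (?h x)) \<partial>lborel) < \<infinity>"
    by (subst nn_integral_cong[where v = "\<lambda>x. ennreal ((1 + x) powr (-1 - d)) * indicator {0..} x"])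
       (auto simp: indicator_def)
  then have h: "integrable lborel ?h"
    by (intro integrableI_bounded) auto
  have "integrable lborel (\<lambda>x. ?h x + ?h (0 + (-1) * x))"
    by (intro Bochner_Integration.integrable_add h lborel_integrable_real_affine) auto
  then show ?thesis
    by (rule Bochner_Integration.integrable_bound) (auto simp: indicator_def)
qed

text \<open>
  Since \<open>norm x\<close> dominates each of the \<open>n\<close> coordinates,
  \<open>(1 + norm x) powr (- n - d)\<close> is at most the product over the coordinates of
  \<open>(1 + \<bar>x \<bullet> b\<bar>) powr (- 1 - d / n)\<close>.
\<close>
lemma integrable_one_plus_norm_powr:
  fixes d :: real
  assumes "d > 0"
  shows "integrable lborel (\<lambda>x::'a::euclidean_space. (1 + norm x) powr (- real DIM('a) - d))"
proof -
  let ?n = "real DIM('a)"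
  have int: "integrable lborel (\<lambda>x::'a. \<Prod>b\<in>Basis. (1 + \<bar>x \<bullet> b\<bar>) powr (-1 - d / ?n))"
    using assms by (intro integrable_lborel_prod integrable_one_plus_abs_powr) simp
  show ?thesis
  proof (rule Bochner_Integration.integrable_bound[OF int], measurable, rule AE_I2)
    fix x :: 'a
    have "(1 + norm x) powr (- ?n - d) = (\<Prod>b\<in>(Basis::'a set). (1 + norm x) powr (-1 - d / ?n))"
    proof -
      have "(-1 - d / ?n) * ?n = - ?n - d" by (simp add: field_simps)
      then show ?thesis by (simp add: powr_powr flip: powr_realpow')
    qed
    also have "\<dots> \<le> (\<Prod>b\<in>Basis. (1 + \<bar>x \<bullet> b\<bar>) powr (-1 - d / ?n))"
      using assms by (intro prod_mono conjI powr_mono2') (auto simp: Basis_le_norm intro: add_pos_nonneg order_trans[of _ 0])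
    finally show "norm ((1 + norm x) powr (- ?n - d)) \<le>
        norm (\<Prod>b\<in>Basis. (1 + \<bar>x \<bullet> b\<bar>) powr (-1 - d / ?n))"
      by (simp add: prod_nonneg)
  qed
qed

section \<open>The Fourier transform of the Gaussian\<close>

text \<open>
  The standard normal density on a Euclidean space.
\<close>
definition gauss :: "'a::euclidean_space \<Rightarrow> real" where
  "gauss x = exp (- (norm x)\<^sup>2 / 2) / sqrt (2 * pi) ^ DIM('a)"

lemma gauss_prod: "gauss x = (\<Prod>b\<in>Basis. std_normal_density (x \<bullet> b))"
proof -
  have "(\<Prod>b\<in>Basis. std_normal_density (x \<bullet> b)) =
     (\<Prod>b\<in>Basis. exp (- (x \<bullet> b)\<^sup>2 / 2)) * (1 / sqrt (2 * pi)) ^ DIM('a)"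
    by (simp add: std_normal_density_def prod.distrib prod_dividef power_one_over)
  also have "(\<Prod>b\<in>Basis. exp (- (x \<bullet> b)\<^sup>2 / 2)) = exp (\<Sum>b\<in>Basis. - (x \<bullet> b)\<^sup>2 / 2)"
    by (simp add: exp_sum)
  also have "(\<Sum>b\<in>Basis. - (x \<bullet> b)\<^sup>2 / 2) = - (norm x)\<^sup>2 / 2"
    by (simp add: norm_eq_sqrt_inner real_sqrt_pow2 sum_nonneg sum_divide_distrib sum_negf euclidean_inner[of x x] power2_eq_square)
  finally show ?thesis by (simp add: gauss_def power_one_over field_simps)
qed

lemma gauss_nonneg: "gauss x \<ge> 0"
  by (simp add: gauss_def)

lemma continuous_gauss: "continuous_on UNIV (gauss :: 'a::euclidean_space \<Rightarrow> real)"
  unfolding gauss_def by (intro continuous_intros) auto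

lemma borel_measurable_gauss [measurable]: "gauss \<in> borel_measurable borel"
  by (rule borel_measurable_continuous_onI[OF continuous_gauss])

lemma integrable_gauss: "integrable lborel (gauss :: 'a::euclidean_space \<Rightarrow> real)"
  unfolding gauss_prod[abs_def] by (intro integrable_lborel_prod) simp

lemma integral_gauss: "(LINT x|lborel. gauss (x::'a::euclidean_space)) = 1"
  unfolding gauss_prod by (subst integral_lborel_prod) auto

lemma gauss_char_1:
  "(LINT x|lborel. complex_of_real (std_normal_density x) * iexp (t * x)) = exp (- t\<^sup>2 / 2)"
proof -
  have "(LINT x|lborel. complex_of_real (std_normal_density x) * iexp (t * x)) = char std_normal_distribution t"
    unfolding char_def by (subst integral_density) (auto simp: scaleR_conv_of_real)
  then show ?thesis by (simp add: char_std_normal_distribution)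
qed

text \<open>
  The standard Gaussian is, up to the factor \<open>(2 \<pi>)\<^sup>n\<^sup>/\<^sup>2\<close>, its own Fourier transform
  (with the kernel \<open>exp (\<i> (x \<bullet> u))\<close>). It factors over the coordinates, so the one-dimensional
  characteristic function suffices.
\<close>
lemma gauss_char:
  fixes u :: "'a::euclidean_space"
  shows "(LINT x|lborel. complex_of_real (gauss x) * iexp (x \<bullet> u)) = exp (- (norm u)\<^sup>2 / 2)"
proof -
  let ?g = "\<lambda>b y. complex_of_real (std_normal_density y) * iexp ((u \<bullet> b) * y)"
  have int: "integrable lborel (?g b)" for b
    by (rule Bochner_Integration.integrable_bound[OF integrable_normal_density[of 1 0]]) (auto simp: norm_mult)
  have "complex_of_real (gauss x) * iexp (x \<bullet> u) = (\<Prod>b\<in>Basis. ?g b (x \<bullet> b))" for x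
  proof -
    have "iexp (x \<bullet> u) = (\<Prod>b\<in>Basis. iexp ((u \<bullet> b) * (x \<bullet> b)))"
      by (subst euclidean_inner) (simp add: exp_sum sum_distrib_left mult.commute)
    then show ?thesis by (simp add: gauss_prod prod.distrib)
  qed
  then have "(LINT x|lborel. complex_of_real (gauss x) * iexp (x \<bullet> u)) = (\<Prod>b\<in>Basis. complex_of_real (exp (- (u \<bullet> b)\<^sup>2 / 2)))"
    by (simp only: integral_lborel_prod[OF int] gauss_char_1)
  also have "\<dots> = exp (of_real (\<Sum>b\<in>Basis. - (u \<bullet> b)\<^sup>2 / 2))"
    by (simp only: exp_of_real exp_sum[OF finite_Basis] of_real_prod)
  also have "(\<Sum>b\<in>Basis. - (u \<bullet> b)\<^sup>2 / 2) = - (norm u)\<^sup>2 / 2"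
    by (simp add: norm_eq_sqrt_inner real_sqrt_pow2 sum_nonneg sum_divide_distrib sum_negf euclidean_inner[of u u] power2_eq_square)
  finally show ?thesis by (simp only: exp_of_real)
qed

section \<open>Fourier inversion\<close>

lemma borel_measurable_cnj [measurable (raw)]:
  "g \<in> borel_measurable M \<Longrightarrow> (\<lambda>x. cnj (g x)) \<in> borel_measurable M"
  by (rule borel_measurable_continuous_on[where f = cnj]) (auto intro: continuous_intros)

text \<open>
  The character \<open>exp (2 \<pi> \<i> (x \<bullet> t))\<close>, the kernel of the Fourier transform.
\<close>
definition ech :: "'a::euclidean_space \<Rightarrow> 'a \<Rightarrow> complex" where
  "ech x t = exp (2 * pi * \<i> * complex_of_real (x \<bullet> t))"

lemma norm_ech [simp]: "norm (ech x t) = 1"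
  by (simp add: ech_def)

lemma ech_diff: "ech (x - y) t = ech x t * cnj (ech y t)"
  by (simp add: ech_def exp_cnj flip: exp_add) (simp add: algebra_simps inner_diff_left)

lemma ech_zero [simp]: "ech x 0 = 1" "ech 0 t = 1"
  by (simp_all add: ech_def)

lemma borel_measurable_ech [measurable (raw)]:
  "g \<in> borel_measurable M \<Longrightarrow> h \<in> borel_measurable M \<Longrightarrow> (\<lambda>z. ech (g z) (h z)) \<in> borel_measurable M"
  unfolding ech_def by measurable

lemma fourier_ech: "fourier f t = (LINT x|lborel. complex_of_real (f x) * ech x t)"
  by (simp add: fourier_def ech_def)

lemma integrable_mult_bounded:
  fixes f g :: "'a \<Rightarrow> complex"
  assumes "integrable M f" "g \<in> borel_measurable M" "\<And>x. norm (g x) \<le> B"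
  shows "integrable M (\<lambda>x. f x * g x)"
proof (rule Bochner_Integration.integrable_bound)
  show "integrable M (\<lambda>x. B * norm (f x))" using assms by auto
  show "(\<lambda>x. f x * g x) \<in> borel_measurable M" using assms by auto
  have "norm (f x) * norm (g x) \<le> \<bar>B\<bar> * norm (f x)" for x
    using assms(3)[of x] by (subst mult.commute) (intro mult_right_mono, auto)
  then show "AE x in M. norm (f x * g x) \<le> norm (B * norm (f x))"
    by (simp add: norm_mult abs_mult)
qed

lemma continuous_fourier:
  assumes f: "integrable lborel f"
  shows "continuous_on UNIV (fourier f)"
  unfolding continuous_on_sequentially
proof (intro allI impI ballI, elim conjE)
  fix t and u :: "nat \<Rightarrow> real ^ 'a" assume u: "u \<longlonglongrightarrow> t"
  have [measurable]: "f \<in> borel_measurable borel" using f by auto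
  have *: "(\<lambda>n. LINT x|lborel. complex_of_real (f x) * ech x (u n)) \<longlonglongrightarrow> (LINT x|lborel. complex_of_real (f x) * ech x t)"
  proof (rule integral_dominated_convergence[where w = "\<lambda>x. \<bar>f x\<bar>"])
    show "AE x in lborel. (\<lambda>n. complex_of_real (f x) * ech x (u n)) \<longlonglongrightarrow> complex_of_real (f x) * ech x t"
      unfolding ech_def by (intro AE_I2 tendsto_intros u)
  qed (use f in \<open>auto simp: norm_mult\<close>)
  then show "(fourier f \<circ> u) \<longlonglongrightarrow> fourier f t"
    by (simp add: fourier_ech[abs_def] o_def)
qed

lemma integral_gauss_dilation_ech:
  fixes w :: "'a::euclidean_space"
  assumes s: "s > 0"
  shows "(LINT t|lborel. complex_of_real (gauss (s *\<^sub>R t)) * ech w t) =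
    of_real ((sqrt (2 * pi) / s) ^ DIM('a) * gauss ((2 * pi / s) *\<^sub>R w))"
proof -
  let ?u = "(2 * pi / s) *\<^sub>R w"
  have "(LINT t|lborel. complex_of_real (gauss (s *\<^sub>R t)) * ech w t) =
     (1 / s) ^ DIM('a) *\<^sub>R (LINT t|lborel. complex_of_real (gauss t) * iexp (t \<bullet> ?u))"
    using s by (subst integral_lborel_affine[where c = "1 / s" and t = 0])
       (auto simp: ech_def inner_commute mult_ac)
  also have "\<dots> = of_real ((1 / s) ^ DIM('a) * exp (- (norm ?u)\<^sup>2 / 2))"
    by (subst gauss_char) (simp add: scaleR_conv_of_real)
  also have "(1 / s) ^ DIM('a) * exp (- (norm ?u)\<^sup>2 / 2) = (sqrt (2 * pi) / s) ^ DIM('a) * gauss ?u"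
    by (simp add: gauss_def power_divide)
  finally show ?thesis .
qed

text \<open>
  Damping the inversion integral by a Gaussian makes Fubini applicable. The result is \<open>f\<close> averaged
  near \<open>x\<close> against a Gaussian of width proportional to \<open>s\<close>.
\<close>
lemma fourier_gauss_regularized:
  fixes f :: "real ^ 'n \<Rightarrow> real"
  assumes f: "integrable lborel f" and s: "s > 0"
  shows "(LINT t|lborel. fourier f t * cnj (ech x t) * gauss (s *\<^sub>R t)) =
    of_real (gauss (0 :: real ^ 'n) * (LINT z|lborel. f (x + (s / (2 * pi)) *\<^sub>R z) * gauss z))"
proof -
  have fm [measurable]: "f \<in> borel_measurable borel" using f by auto
  have gs: "integrable lborel (\<lambda>t :: real^'n. gauss (s *\<^sub>R t))"
    using integrable_lborel_affine[OF borel_measurable_gauss, of s 0] s integrable_gauss by simp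
  let ?F = "\<lambda>y t :: real^'n. complex_of_real (f y) * ech (y - x) t * complex_of_real (gauss (s *\<^sub>R t))"
  have F: "integrable (lborel \<Otimes>\<^sub>M lborel) (case_prod ?F)"
  proof (rule lborel_pair.Fubini_integrable)
    show "integrable lborel (\<lambda>y. LINT t|lborel. norm (case (y, t) of (y, t) \<Rightarrow> ?F y t))"
      using f by (simp add: norm_mult)
    show "AE y in lborel. integrable lborel (\<lambda>t. case (y, t) of (y, t) \<Rightarrow> ?F y t)"
      by (intro AE_I2 Bochner_Integration.integrable_bound[OF integrable_mult_right[OF gs, of "f _"]])
         (auto simp: norm_mult abs_mult)
  qed measurable
  have "(LINT t|lborel. fourier f t * cnj (ech x t) * gauss (s *\<^sub>R t)) =
     (LINT t|lborel. LINT y|lborel. ?F y t)"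
  proof (rule Bochner_Integration.integral_cong[OF refl])
    fix t :: "real^'n"
    have "(LINT y|lborel. ?F y t) = (LINT y|lborel. (complex_of_real (f y) * ech y t) * (cnj (ech x t) * gauss (s *\<^sub>R t)))"
      by (simp add: ech_diff mult_ac)
    also have "\<dots> = fourier f t * (cnj (ech x t) * gauss (s *\<^sub>R t))"
      unfolding fourier_ech by (rule integral_mult_left_zero)
    finally show "fourier f t * cnj (ech x t) * gauss (s *\<^sub>R t) = (LINT y|lborel. ?F y t)"
      by (simp add: mult_ac)
  qed
  also have "\<dots> = (LINT y|lborel. LINT t|lborel. ?F y t)"
    by (rule lborel_pair.Fubini_integral[OF F])
  also have "\<dots> = (LINT y|lborel. complex_of_real (f y) *
      of_real ((sqrt (2 * pi) / s) ^ CARD('n) * gauss ((2 * pi / s) *\<^sub>R (y - x))))"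
  proof (rule Bochner_Integration.integral_cong[OF refl])
    fix y
    have "(LINT t|lborel. ?F y t) = (LINT t|lborel. complex_of_real (f y) * (complex_of_real (gauss (s *\<^sub>R t)) * ech (y - x) t))"
      by (simp add: mult_ac)
    also have "\<dots> = complex_of_real (f y) * (LINT t|lborel. complex_of_real (gauss (s *\<^sub>R t)) * ech (y - x) t)"
      by (rule integral_mult_right_zero)
    finally show "(LINT t|lborel. ?F y t) = complex_of_real (f y) *
      of_real ((sqrt (2 * pi) / s) ^ CARD('n) * gauss ((2 * pi / s) *\<^sub>R (y - x)))"
      by (simp add: integral_gauss_dilation_ech[OF s])
  qed
  also have "\<dots> = of_real (LINT y|lborel. f y * ((sqrt (2 * pi) / s) ^ CARD('n) * gauss ((2 * pi / s) *\<^sub>R (y - x))))"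
    by (simp flip: of_real_mult)
  also have "(LINT y|lborel. f y * ((sqrt (2 * pi) / s) ^ CARD('n) * gauss ((2 * pi / s) *\<^sub>R (y - x)))) =
     (s / (2 * pi)) ^ CARD('n) * (LINT z|lborel. (sqrt (2 * pi) / s) ^ CARD('n) * (f (x + (s / (2 * pi)) *\<^sub>R z) * gauss z))"
    using s by (subst integral_lborel_affine[where c = "s / (2 * pi)" and t = x]) (auto simp: mult_ac)
  also have "\<dots> = ((s / (2 * pi)) ^ CARD('n) * (sqrt (2 * pi) / s) ^ CARD('n)) * (LINT z|lborel. f (x + (s / (2 * pi)) *\<^sub>R z) * gauss z)"
    by simp
  also have "(s / (2 * pi)) ^ CARD('n) * (sqrt (2 * pi) / s) ^ CARD('n) = gauss (0 :: real^'n)"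
  proof -
    have "s / (2 * pi) * (sqrt (2 * pi) / s) = 1 / sqrt (2 * pi)"
      using s by (simp add: field_simps flip: real_sqrt_mult)
    then show ?thesis
      by (simp add: gauss_def power_one_over flip: power_mult_distrib)
  qed
  finally show ?thesis .
qed

text \<open>
  Both sides of the regularized identity converge as \<open>s\<close> tends to 0, by dominated convergence.
\<close>
theorem fourier_inversion:
  fixes f :: "real ^ 'n \<Rightarrow> real"
  assumes cont: "continuous_on UNIV f" and f: "integrable lborel f"
    and bd: "\<And>x. \<bar>f x\<bar> \<le> C" and fhat: "integrable lborel (fourier f)"
  shows "(LINT t|lborel. fourier f t * cnj (ech x t)) = f x"
proof -
  define s where "s k = 1 / real (Suc k)" for k
  have s: "s k > 0" for k by (simp add: s_def)
  have s0: "s \<longlonglongrightarrow> 0"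
    using LIMSEQ_inverse_real_of_nat unfolding s_def[abs_def] by (simp add: inverse_eq_divide)
  have [measurable]: "f \<in> borel_measurable borel" using f by auto
  have [measurable]: "fourier f \<in> borel_measurable borel" using fhat by auto
  have fi: "isCont f y" for y using cont by (simp add: continuous_on_eq_continuous_at)
  have gi: "isCont gauss (y :: real^'n)" for y using continuous_gauss[where 'a = "real^'n"] by (simp add: continuous_on_eq_continuous_at)
  have gb: "gauss y \<le> 1 / sqrt (2 * pi) ^ CARD('n)" for y :: "real^'n"
    by (simp add: gauss_def divide_right_mono)
  let ?L = "\<lambda>k. LINT t|lborel. fourier f t * cnj (ech x t) * gauss (s k *\<^sub>R t)"
  have "?L \<longlonglongrightarrow> (LINT t|lborel. fourier f t * cnj (ech x t) * gauss (0 *\<^sub>R t))"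
  proof (rule integral_dominated_convergence[where w = "\<lambda>t. norm (fourier f t) * (1 / sqrt (2 * pi) ^ CARD('n))"])
    show "AE t in lborel. (\<lambda>k. fourier f t * cnj (ech x t) * gauss (s k *\<^sub>R t)) \<longlonglongrightarrow> fourier f t * cnj (ech x t) * gauss (0 *\<^sub>R t)"
      by (intro AE_I2 tendsto_intros isCont_tendsto_compose[OF gi] s0)
    show "AE t in lborel. norm (fourier f t * cnj (ech x t) * gauss (s k *\<^sub>R t)) \<le> norm (fourier f t) * (1 / sqrt (2 * pi) ^ CARD('n))" for k
      using gb by (intro AE_I2) (simp only: norm_mult norm_ech complex_mod_cnj norm_of_real abs_of_nonneg[OF gauss_nonneg] mult_1_right, intro mult_left_mono, auto)
  qed (use fhat in auto)
  also have "(LINT t|lborel. fourier f t * cnj (ech x t) * gauss (0 *\<^sub>R t)) = (LINT t|lborel. fourier f t * cnj (ech x t)) * gauss (0 :: real^'n)"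
    by simp
  finally have lim1: "?L \<longlonglongrightarrow> (LINT t|lborel. fourier f t * cnj (ech x t)) * gauss (0 :: real^'n)" .
  have "(\<lambda>k. LINT z|lborel. f (x + (s k / (2 * pi)) *\<^sub>R z) * gauss z) \<longlonglongrightarrow> (LINT z::real^'n|lborel. f x * gauss z)"
  proof (rule integral_dominated_convergence[where w = "\<lambda>z :: real^'n. C * gauss z"])
    have "(\<lambda>k. x + (s k / (2 * pi)) *\<^sub>R z) \<longlonglongrightarrow> x + (0 / (2 * pi)) *\<^sub>R z" for z
      by (intro tendsto_intros s0) simp
    then have "(\<lambda>k. f (x + (s k / (2 * pi)) *\<^sub>R z)) \<longlonglongrightarrow> f x" for z
      by (intro isCont_tendsto_compose[OF fi]) simp
    then show "AE z in lborel. (\<lambda>k. f (x + (s k / (2 * pi)) *\<^sub>R z) * gauss z) \<longlonglongrightarrow> f x * gauss z"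
      by (intro AE_I2 tendsto_intros)
    show "AE z in lborel. norm (f (x + (s k / (2 * pi)) *\<^sub>R z) * gauss z) \<le> C * gauss z" for k
      using bd by (intro AE_I2) (simp add: abs_mult gauss_nonneg mult_right_mono)
  qed (auto intro: integrable_gauss)
  then have "(\<lambda>k. LINT z|lborel. f (x + (s k / (2 * pi)) *\<^sub>R z) * gauss z) \<longlonglongrightarrow> f x"
    by (simp add: integral_gauss)
  then have "?L \<longlonglongrightarrow> of_real (gauss (0 :: real^'n) * f x)"
    unfolding fourier_gauss_regularized[OF f s] by (intro tendsto_intros)
  from LIMSEQ_unique[OF lim1 this] show ?thesis
    by (simp add: gauss_def)
qed

section \<open>Positive definiteness\<close>

text \<open>
  The Fourier transform of a finite Borel measure.
\<close>
definition fourier_measure :: "'a::euclidean_space measure \<Rightarrow> 'a \<Rightarrow> complex" where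
  "fourier_measure \<nu> t = (LINT y|\<nu>. ech y t)"

lemma
  fixes \<nu> :: "'a::euclidean_space measure"
  assumes "finite_measure \<nu>" and sets [measurable_cong]: "sets \<nu> = sets borel"
  shows borel_measurable_fourier_measure: "fourier_measure \<nu> \<in> borel_measurable borel"
    and norm_fourier_measure: "norm (fourier_measure \<nu> t) \<le> measure \<nu> UNIV"
proof -
  interpret finite_measure \<nu> by fact
  show "fourier_measure \<nu> \<in> borel_measurable borel"
    unfolding fourier_measure_def[abs_def] by measurable
  have "norm (fourier_measure \<nu> t) \<le> (LINT y|\<nu>. norm (ech y t))"
    unfolding fourier_measure_def by (rule integral_norm_bound)
  then show "norm (fourier_measure \<nu> t) \<le> measure \<nu> UNIV"
    using sets_eq_imp_space_eq[OF sets] by simp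
qed

lemma integral_mult_fourier_measure:
  fixes \<nu> :: "'a::euclidean_space measure"
  assumes \<nu>: "finite_measure \<nu>" and sets [measurable_cong]: "sets \<nu> = sets borel"
    and v: "integrable lborel v"
  shows "(LINT t|lborel. v t * fourier_measure \<nu> t) = (LINT y|\<nu>. LINT t|lborel. v t * ech y t)"
proof -
  interpret finite_measure \<nu> by fact
  interpret P: pair_sigma_finite "lborel :: 'a measure" \<nu> ..
  have [measurable]: "v \<in> borel_measurable borel" using v by auto
  have "integrable (lborel \<Otimes>\<^sub>M \<nu>) (\<lambda>(t, y). v t * ech y t)"
  proof (rule P.Fubini_integrable)
    show "integrable lborel (\<lambda>t. LINT y|\<nu>. norm (case (t, y) of (t, y) \<Rightarrow> v t * ech y t))"
      using v by (simp add: norm_mult)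
    show "AE t in lborel. integrable \<nu> (\<lambda>y. case (t, y) of (t, y) \<Rightarrow> v t * ech y t)"
    proof (intro AE_I2)
      fix t
      show "integrable \<nu> (\<lambda>y. case (t, y) of (t, y) \<Rightarrow> v t * ech y t)"
        by (intro integrable_const_bound[where B = "norm (v t)"]) (auto simp: norm_mult)
    qed
  qed measurable
  from P.Fubini_integral[OF this] show ?thesis
    by (simp add: fourier_measure_def)
qed

lemma integral_fourier_measure_cnj_fourier_measure:
  fixes \<mu> \<nu> :: "'a::euclidean_space measure"
  assumes \<mu>: "finite_measure \<mu>" "sets \<mu> = sets borel"
    and \<nu>: "finite_measure \<nu>" "sets \<nu> = sets borel"
    and u: "integrable lborel u"
  shows "(LINT t|lborel. u t * (cnj (fourier_measure \<mu> t) * fourier_measure \<nu> t)) =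
    (LINT y|\<nu>. LINT x|\<mu>. LINT t|lborel. u t * cnj (ech (x - y) t))"
proof -
  note [measurable] = borel_measurable_fourier_measure[OF \<mu>] borel_measurable_fourier_measure[OF \<nu>]
  have "integrable lborel (\<lambda>t. u t * cnj (fourier_measure \<mu> t))"
    using norm_fourier_measure[OF \<mu>] by (intro integrable_mult_bounded[OF u]) auto
  from integral_mult_fourier_measure[OF \<nu> this]
  have "(LINT t|lborel. u t * (cnj (fourier_measure \<mu> t) * fourier_measure \<nu> t)) =
      (LINT y|\<nu>. LINT t|lborel. u t * cnj (fourier_measure \<mu> t) * ech y t)"
    by (simp add: mult.assoc)
  also have "\<dots> = (LINT y|\<nu>. LINT x|\<mu>. LINT t|lborel. u t * cnj (ech (x - y) t))"
  proof (rule Bochner_Integration.integral_cong[OF refl])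
    fix y
    have "integrable lborel (\<lambda>t. u t * ech y t)"
      by (intro integrable_mult_bounded[OF u, where B=1]) auto
    then have "integrable lborel (\<lambda>t. cnj (u t * ech y t))"
      by (simp only: integrable_cnj)
    from integral_mult_fourier_measure[OF \<mu> this]
    have "cnj (LINT t|lborel. cnj (u t * ech y t) * fourier_measure \<mu> t) =
        cnj (LINT x|\<mu>. LINT t|lborel. cnj (u t * ech y t) * ech x t)" by simp
    then show "(LINT t|lborel. u t * cnj (fourier_measure \<mu> t) * ech y t) =
        (LINT x|\<mu>. LINT t|lborel. u t * cnj (ech (x - y) t))"
      unfolding Bochner_Integration.integral_cnj[symmetric]
      by (simp add: ech_diff mult_ac del: Bochner_Integration.integral_cnj)
  qed
  finally show ?thesis .
qed

text \<open>
  The inverse Fourier transform \<open>f\<close> of a nonnegative integrable function \<open>u\<close> is positive definite,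
  here in integrated form: the energy of the signed measure \<open>\<mu> - \<nu>\<close> with respect to the kernel
  \<open>f (x - y)\<close> is the integral of \<open>u\<close> times the squared modulus of the Fourier transform of
  \<open>\<mu> - \<nu>\<close>. The two mixed terms are complex conjugates and appear as one.
\<close>
lemma energy_nonneg:
  fixes \<mu> \<nu> :: "'a::euclidean_space measure" and f :: "'a \<Rightarrow> real"
  assumes \<mu>: "finite_measure \<mu>" "sets \<mu> = sets borel"
    and \<nu>: "finite_measure \<nu>" "sets \<nu> = sets borel"
    and u: "integrable lborel u" and pos: "\<And>t. u t \<in> \<real>\<^sub>\<ge>\<^sub>0"
    and f: "\<And>x. (LINT t|lborel. u t * cnj (ech x t)) = f x"
  shows "0 \<le> (LINT y|\<mu>. LINT x|\<mu>. f (x - y)) - 2 * (LINT y|\<nu>. LINT x|\<mu>. f (x - y))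
    + (LINT y|\<nu>. LINT x|\<nu>. f (x - y))"
proof -
  note [measurable] = borel_measurable_fourier_measure[OF \<mu>] borel_measurable_fourier_measure[OF \<nu>]
  let ?E = "\<lambda>\<mu> \<nu> t. u t * (cnj (fourier_measure \<mu> t) * fourier_measure \<nu> t)"
  have int: "integrable lborel (?E \<mu>' \<nu>')" if "\<mu>' \<in> {\<mu>, \<nu>}" "\<nu>' \<in> {\<mu>, \<nu>}" for \<mu>' \<nu>'
  proof (rule integrable_mult_bounded[OF u])
    show "norm (cnj (fourier_measure \<mu>' t) * fourier_measure \<nu>' t) \<le> measure \<mu>' UNIV * measure \<nu>' UNIV" for t
      using that norm_fourier_measure[OF \<mu>, of t] norm_fourier_measure[OF \<nu>, of t]
      by (auto simp: norm_mult intro!: mult_mono)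
  qed (use that in auto)
  have E: "(LINT t|lborel. Re (?E \<mu>' \<nu>' t)) = (LINT y|\<nu>'. LINT x|\<mu>'. f (x - y))"
    if "\<mu>' \<in> {\<mu>, \<nu>}" "\<nu>' \<in> {\<mu>, \<nu>}" for \<mu>' \<nu>'
  proof -
    have "(LINT t|lborel. ?E \<mu>' \<nu>' t) = of_real (LINT y|\<nu>'. LINT x|\<mu>'. f (x - y))"
      using that \<mu> \<nu> u by (subst integral_fourier_measure_cnj_fourier_measure) (auto simp: f)
    then show ?thesis by (subst integral_Re[OF int[OF that]]) simp
  qed
  have "0 \<le> (LINT t|lborel. Re (?E \<mu> \<mu> t) - 2 * Re (?E \<mu> \<nu> t) + Re (?E \<nu> \<nu> t))"
  proof (rule integral_nonneg_AE, rule AE_I2)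
    fix t
    obtain r where r: "u t = of_real r" "r \<ge> 0" using pos[of t] by (auto elim: nonneg_Reals_cases)
    have "Re (?E \<mu> \<mu> t) - 2 * Re (?E \<mu> \<nu> t) + Re (?E \<nu> \<nu> t) = r * (norm (fourier_measure \<mu> t - fourier_measure \<nu> t))\<^sup>2"
      by (simp add: r cmod_power2) (simp add: algebra_simps power2_eq_square)
    then show "0 \<le> Re (?E \<mu> \<mu> t) - 2 * Re (?E \<mu> \<nu> t) + Re (?E \<nu> \<nu> t)" using r by simp
  qed
  also have "\<dots> = (LINT t|lborel. Re (?E \<mu> \<mu> t)) - 2 * (LINT t|lborel. Re (?E \<mu> \<nu> t)) + (LINT t|lborel. Re (?E \<nu> \<nu> t))"
  proof -
    define a where "a \<mu> \<nu> t = Re (?E \<mu> \<nu> t)" for \<mu> \<nu> t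
    have "integrable lborel (a \<mu> \<mu>)" "integrable lborel (a \<mu> \<nu>)" "integrable lborel (a \<nu> \<nu>)"
      unfolding a_def[abs_def] by (intro integrable_Re int; simp)+
    then show ?thesis by (fold a_def) simp
  qed
  finally show ?thesis
    by (simp only: E[OF insertI1 insertI1] E[OF insertI1 insertI2[OF singletonI]]
        E[OF insertI2[OF singletonI] insertI2[OF singletonI]])
qed

section \<open>Separated finite point sets\<close>

text \<open>
  The sign \<open>c\<close> allows for both \<open>f (y - x)\<close> and \<open>f (x - y)\<close>. If \<open>B\<close> contains the ball of radius \<open>L\<close>
  around \<open>x\<close>, integrating over \<open>B\<close> loses only mass of \<open>f\<close> outside the ball of radius \<open>L\<close>.
\<close>
lemma
  fixes f :: "'a::euclidean_space \<Rightarrow> real"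
  assumes f: "integrable lborel f" and c: "\<bar>c\<bar> = 1" and [measurable]: "B \<in> sets borel"
  shows integrable_indicator_shift: "integrable lborel (\<lambda>y. indicator B y * f (c *\<^sub>R (y - x)))"
    and abs_integral_indicator_shift_le:
      "\<bar>LINT y|lborel. indicator B y * f (c *\<^sub>R (y - x))\<bar> \<le> (LINT z|lborel. \<bar>f z\<bar>)"
    and integral_indicator_shift_approx: "cball x L \<subseteq> B \<Longrightarrow>
      \<bar>(LINT y|lborel. indicator B y * f (c *\<^sub>R (y - x))) - (LINT z|lborel. f z)\<bar>
        \<le> (LINT z|lborel. indicator (- cball 0 L) z * \<bar>f z\<bar>)"
proof -
  have [measurable]: "f \<in> borel_measurable borel" using f by auto
  have c0: "c \<noteq> 0" using c by auto
  have arg: "- (c *\<^sub>R x) + c *\<^sub>R y = c *\<^sub>R (y - x)" for y by (simp add: algebra_simps)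
  have shift: "(LINT y|lborel. h (c *\<^sub>R (y - x))) = (LINT z|lborel. h z)"
    if "h \<in> borel_measurable borel" for h :: "'a \<Rightarrow> real"
    using integral_lborel_affine[OF that c0, of "- (c *\<^sub>R x)"] c by (simp only: arg power_one) simp
  have int: "integrable lborel (\<lambda>y. f (c *\<^sub>R (y - x)))"
    using integrable_lborel_affine[OF _ c0 f, of "- (c *\<^sub>R x)"] by (simp only: arg) auto
  have indint: "integrable lborel (\<lambda>y. indicator S y * g y)" if "integrable lborel g" "S \<in> sets borel"
    for g :: "'a \<Rightarrow> real" and S
    using that by (intro Bochner_Integration.integrable_bound[OF that(1)]) (auto simp: indicator_def)
  show intB: "integrable lborel (\<lambda>y. indicator B y * f (c *\<^sub>R (y - x)))"
    by (rule indint[OF int]) simp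
  have "\<bar>LINT y|lborel. indicator B y * f (c *\<^sub>R (y - x))\<bar> \<le> (LINT y|lborel. \<bar>indicator B y * f (c *\<^sub>R (y - x))\<bar>)"
    by (rule integral_abs_bound)
  also have "\<dots> \<le> (LINT y|lborel. \<bar>f (c *\<^sub>R (y - x))\<bar>)"
    using intB int by (intro integral_mono) (auto simp: indicator_def)
  also have "\<dots> = (LINT z|lborel. \<bar>f z\<bar>)" by (rule shift) simp
  finally show "\<bar>LINT y|lborel. indicator B y * f (c *\<^sub>R (y - x))\<bar> \<le> (LINT z|lborel. \<bar>f z\<bar>)" .
  assume sub: "cball x L \<subseteq> B"
  have out: "indicator (- B) y \<le> (indicator (- cball 0 L) (c *\<^sub>R (y - x)) :: real)" for y
    using sub c by (auto simp: indicator_def dist_norm norm_minus_commute subset_iff)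
  have "(LINT y|lborel. indicator B y * f (c *\<^sub>R (y - x))) - (LINT z|lborel. f z) =
      (LINT y|lborel. indicator B y * f (c *\<^sub>R (y - x))) - (LINT y|lborel. f (c *\<^sub>R (y - x)))"
    by (simp add: shift)
  also have "\<dots> = (LINT y|lborel. indicator B y * f (c *\<^sub>R (y - x)) - f (c *\<^sub>R (y - x)))"
    using intB int by simp
  also have "\<bar>\<dots>\<bar> \<le> (LINT y|lborel. \<bar>indicator B y * f (c *\<^sub>R (y - x)) - f (c *\<^sub>R (y - x))\<bar>)"
    by (rule integral_abs_bound)
  also have "\<dots> = (LINT y|lborel. indicator (- B) y * \<bar>f (c *\<^sub>R (y - x))\<bar>)"
    by (rule Bochner_Integration.integral_cong) (auto simp: indicator_def)
  also have "\<dots> \<le> (LINT y|lborel. indicator (- cball 0 L) (c *\<^sub>R (y - x)) * \<bar>f (c *\<^sub>R (y - x))\<bar>)"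
  proof (rule integral_mono)
    show "integrable lborel (\<lambda>y. indicator (- B) y * \<bar>f (c *\<^sub>R (y - x))\<bar>)"
      using int by (intro indint) auto
    show "integrable lborel (\<lambda>y. indicator (- cball 0 L) (c *\<^sub>R (y - x)) * \<bar>f (c *\<^sub>R (y - x))\<bar>)"
      by (rule Bochner_Integration.integrable_bound[OF int]) (auto simp: indicator_def)
  qed (use out in \<open>auto intro!: mult_right_mono\<close>)
  also have "\<dots> = (LINT z|lborel. indicator (- cball 0 L) z * \<bar>f z\<bar>)"
    by (rule shift) measurable
  finally show "\<bar>(LINT y|lborel. indicator B y * f (c *\<^sub>R (y - x))) - (LINT z|lborel. f z)\<bar>
        \<le> (LINT z|lborel. indicator (- cball 0 L) z * \<bar>f z\<bar>)" .
qed

text \<open>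
  The linear programming bound for a finite point set. Let \<open>I\<close>, \<open>J\<close>, \<open>A\<close> be the integral of \<open>f\<close>, the integral
  of \<open>\<bar>f\<bar>\<close> outside the ball of radius \<open>L\<close>, and the integral of \<open>\<bar>f\<bar>\<close>; let \<open>\<kappa>\<close> be the ratio of the
  volumes of the balls of radii \<open>T\<close> and \<open>T + L\<close>. For a set of \<open>N\<close> points in the smaller ball, with
  mutual distances at least 1, the energy of the sum of the point masses minus \<open>\<rho>\<close> times Lebesgue measure on
  the larger ball is nonnegative. The choice \<open>\<rho> = N / v\<close>, with \<open>v\<close> the volume of the larger ball, makes the
  total masses equal.
\<close>
lemma separated_card_bound:
  fixes f :: "'a::euclidean_space \<Rightarrow> real" and p :: 'a
  assumes f: "integrable lborel f" and nonpos: "\<And>x. norm x \<ge> 1 \<Longrightarrow> f x \<le> 0"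
    and u: "integrable lborel u" and upos: "\<And>t. u t \<in> \<real>\<^sub>\<ge>\<^sub>0"
    and inv: "\<And>x. (LINT t|lborel. u t * cnj (ech x t)) = f x"
    and I: "(LINT z|lborel. f z) \<ge> 0"
    and X: "finite X" "X \<subseteq> cball p T" and sep: "\<And>x y. x \<in> X \<Longrightarrow> y \<in> X \<Longrightarrow> x \<noteq> y \<Longrightarrow> dist x y \<ge> 1"
    and T: "T > 0" and L: "L > 0"
  shows "real (card X) * ((LINT z|lborel. f z) - 3 * (LINT z|lborel. indicator (- cball 0 L) z * \<bar>f z\<bar>)
            - (1 - (T / (T + L)) ^ DIM('a)) * (LINT z|lborel. \<bar>f z\<bar>))
         \<le> f 0 * (unit_ball_vol DIM('a) * (T + L) ^ DIM('a))"
proof -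
  define I J A where "I = (LINT z|lborel. f z)" and "J = (LINT z|lborel. indicator (- cball 0 L) z * \<bar>f z\<bar>)"
    and "A = (LINT z|lborel. \<bar>f z\<bar>)"
  define B B0 :: "'a set" where "B = cball p (T + L)" and "B0 = cball p T"
  define N where "N = real (card X)"
  define v where "v = measure lborel B"
  define \<kappa> where "\<kappa> = (T / (T + L)) ^ DIM('a)"
  define \<rho> where "\<rho> = N / v"
  have fm [measurable]: "f \<in> borel_measurable borel" using f by auto
  have Bm [measurable]: "B \<in> sets borel" "B0 \<in> sets borel" by (simp_all add: B_def B0_def)
  have v: "v = unit_ball_vol DIM('a) * (T + L) ^ DIM('a)"
    using T L unfolding v_def B_def by (simp add: content_cball)
  have vpos: "v > 0" using T L by (simp add: v)
  have v0: "measure lborel B0 = \<kappa> * v"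
    using T L unfolding B0_def \<kappa>_def v by (simp add: content_cball power_divide)
  have \<kappa>: "0 \<le> \<kappa>" "\<kappa> \<le> 1" using T L by (auto simp: \<kappa>_def intro!: power_le_one)
  have \<rho>: "\<rho> \<ge> 0" using vpos by (simp add: \<rho>_def N_def)
  have Apos: "A \<ge> 0" "J \<ge> 0" by (auto simp: A_def J_def intro!: integral_nonneg_AE)
  \<comment> \<open>Needed only when \<open>X\<close> is empty.\<close>
  have f0: "f 0 \<ge> 0"
  proof -
    have "f 0 = Re (LINT t|lborel. u t)" using inv[of 0] by simp
    also have "\<dots> = (LINT t|lborel. Re (u t))" by (rule integral_Re[OF u, symmetric])
    also have "\<dots> \<ge> 0" using upos by (intro integral_nonneg_AE AE_I2) (auto simp: complex_nonneg_Reals_iff)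
    finally show ?thesis .
  qed
  define \<mu> :: "'a measure" where "\<mu> = distr (count_space X) borel (\<lambda>x. x)"
  define \<nu> :: "'a measure" where "\<nu> = density lborel (\<lambda>y. ennreal (\<rho> * indicator B y))"
  have \<mu>: "finite_measure \<mu>" "sets \<mu> = sets borel"
    unfolding \<mu>_def using X by (auto intro!: finite_measure.finite_measure_distr finite_measure_count_space)
  have \<nu>: "finite_measure \<nu>" "sets \<nu> = sets borel"
  proof -
    have "emeasure \<nu> UNIV = (\<integral>\<^sup>+y. ennreal \<rho> * indicator B y \<partial>lborel)"
      using \<rho> by (simp add: \<nu>_def emeasure_density ennreal_mult ennreal_indicator)
    also have "\<dots> = ennreal \<rho> * emeasure lborel B" by (simp add: nn_integral_cmult_indicator)
    also have "\<dots> < \<infinity>" unfolding B_def using emeasure_lborel_cball_finite[of p "T + L"] by (simp add: ennreal_mult_less_top)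
    finally show "finite_measure \<nu>" by (intro finite_measureI) (simp add: \<nu>_def)
  qed (simp add: \<nu>_def)
  have int\<mu>: "(LINT x|\<mu>. g x) = (\<Sum>x\<in>X. g x)" if "g \<in> borel_measurable borel" for g :: "'a \<Rightarrow> real"
    unfolding \<mu>_def using that X by (subst integral_distr) (auto simp: lebesgue_integral_count_space_finite)
  have int\<nu>: "(LINT x|\<nu>. g x) = \<rho> * (LINT y|lborel. indicator B y * g y)" if "g \<in> borel_measurable borel" for g :: "'a \<Rightarrow> real"
    unfolding \<nu>_def using that \<rho> by (subst integral_density) (auto simp: mult.assoc)
  note energy = energy_nonneg[OF \<mu> \<nu> u upos inv]
  have t1: "(LINT y|\<mu>. LINT x|\<mu>. f (x - y)) \<le> N * f 0"
  proof -
    have "(LINT y|\<mu>. LINT x|\<mu>. f (x - y)) = (\<Sum>y\<in>X. \<Sum>x\<in>X. f (x - y))"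
      by (simp add: int\<mu>)
    also have "\<dots> \<le> (\<Sum>y\<in>X. f 0)"
    proof (rule sum_mono)
      fix y assume y: "y \<in> X"
      have "(\<Sum>x\<in>X. f (x - y)) = f 0 + (\<Sum>x\<in>X - {y}. f (x - y))"
        using X y by (subst sum.remove[of X y]) auto
      also have "\<dots> \<le> f 0"
        using sep y by (simp, intro sum_nonpos nonpos) (auto simp: dist_norm)
      finally show "(\<Sum>x\<in>X. f (x - y)) \<le> f 0" .
    qed
    finally show ?thesis by (simp add: N_def)
  qed
  have ish: "integrable lborel (\<lambda>y. indicator B y * f ((-1) *\<^sub>R (y - x)))" for x
    by (rule integrable_indicator_shift[OF f]) auto
  have t2: "(LINT y|\<nu>. LINT x|\<mu>. f (x - y)) \<ge> \<rho> * (N * (I - J))"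
  proof -
    have "(LINT y|\<nu>. LINT x|\<mu>. f (x - y)) = \<rho> * (LINT y|lborel. indicator B y * (\<Sum>x\<in>X. f (x - y)))"
      by (simp add: int\<mu> int\<nu>)
    also have "\<dots> = \<rho> * (LINT y|lborel. (\<Sum>x\<in>X. indicator B y * f ((-1) *\<^sub>R (y - x))))"
      by (simp add: sum_distrib_left)
    also have "\<dots> = \<rho> * (\<Sum>x\<in>X. LINT y|lborel. indicator B y * f ((-1) *\<^sub>R (y - x)))"
      by (simp only: Bochner_Integration.integral_sum[OF ish])
    also have "\<dots> \<ge> \<rho> * (\<Sum>x\<in>X. I - J)"
    proof (intro mult_left_mono sum_mono \<rho>)
      fix x assume "x \<in> X"
      then have "cball x L \<subseteq> B" using X unfolding B_def by (intro cball_subset_cball_iff[THEN iffD2]) (auto simp: dist_commute)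
      from integral_indicator_shift_approx[OF f _ _ this, of "-1"]
      show "I - J \<le> (LINT y|lborel. indicator B y * f ((-1) *\<^sub>R (y - x)))"
        by (simp add: I_def J_def abs_le_iff)
    qed
    finally show ?thesis by (simp add: N_def)
  qed
  have t3: "(LINT y|\<nu>. LINT x|\<nu>. f (x - y)) \<le> \<rho> * (\<rho> * (v * (\<kappa> * (I + J) + (1 - \<kappa>) * A)))"
  proof -
    \<comment> \<open>Near the boundary of \<open>B\<close> only the trivial bound \<open>A\<close> is available for the inner integral.\<close>
    define h where "h y = (LINT x|lborel. indicator B x * f (x - y))" for y
    have hm [measurable]: "h \<in> borel_measurable borel" unfolding h_def[abs_def] by measurable
    have hA: "\<bar>h y\<bar> \<le> A" for y
      using abs_integral_indicator_shift_le[OF f, of 1 B y] by (simp add: A_def h_def)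
    have hI: "h y \<le> I + J" if "y \<in> B0" for y
    proof -
      have "cball y L \<subseteq> B" using that unfolding B_def B0_def by (intro cball_subset_cball_iff[THEN iffD2]) (auto simp: dist_commute)
      from integral_indicator_shift_approx[OF f _ _ this, of 1]
      show ?thesis by (simp add: I_def J_def h_def abs_le_iff)
    qed
    have B0B: "B0 \<subseteq> B" using L by (auto simp: B_def B0_def)
    have intB: "integrable lborel (indicat_real B)" "integrable lborel (indicat_real B0)"
      using emeasure_lborel_cball_finite[of p "T + L"] emeasure_lborel_cball_finite[of p T]
      by (auto simp: B_def B0_def integrable_indicator_iff)
    have "(LINT y|\<nu>. LINT x|\<nu>. f (x - y)) = (LINT y|\<nu>. \<rho> * h y)"
      by (simp add: int\<nu> h_def)
    also have "\<dots> = \<rho> * (LINT y|lborel. indicator B y * (\<rho> * h y))"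
      by (rule int\<nu>[where g = "\<lambda>y. \<rho> * h y"]) simp
    also have "(\<lambda>y. indicator B y * (\<rho> * h y)) = (\<lambda>y. \<rho> * (indicator B y * h y))"
      by auto
    also have "\<rho> * (LINT y|lborel. \<rho> * (indicator B y * h y)) = \<rho> * (\<rho> * (LINT y|lborel. indicator B y * h y))"
      by simp
    also have "\<dots> \<le> \<rho> * (\<rho> * (LINT y|lborel. indicator B y * A + indicator B0 y * (I + J - A)))"
    proof (intro mult_left_mono \<rho> integral_mono)
      show "integrable lborel (\<lambda>y. indicator B y * h y)"
        using hA Apos by (intro Bochner_Integration.integrable_bound[OF integrable_mult_left[OF intB(1), of A]]) (auto simp: abs_mult mult_left_mono)
      show "integrable lborel (\<lambda>y. indicator B y * A + indicator B0 y * (I + J - A))"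
        using intB by auto
      show "indicator B y * h y \<le> indicator B y * A + indicator B0 y * (I + J - A)" for y
        using hI[of y] hA[of y] B0B by (auto simp: indicator_def)
    qed
    also have "(LINT y|lborel. indicator B y * A + indicator B0 y * (I + J - A)) = v * A + \<kappa> * v * (I + J - A)"
      using intB v0 by (simp add: v_def)
    also have "\<dots> = v * (\<kappa> * (I + J) + (1 - \<kappa>) * A)" by (simp add: algebra_simps)
    finally show ?thesis .
  qed
  show ?thesis
  proof (cases "N = 0")
    case True
    then show ?thesis using f0 T L by (simp add: N_def)
  next
    case False
    then have N: "N > 0" by (simp add: N_def)
    have "0 \<le> N * f 0 - 2 * (\<rho> * (N * (I - J))) + \<rho> * (\<rho> * (v * (\<kappa> * (I + J) + (1 - \<kappa>) * A)))"
      using energy t1 t2 t3 by linarith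
    also have "\<rho> * (\<rho> * (v * (\<kappa> * (I + J) + (1 - \<kappa>) * A))) = \<rho> * (N * (\<kappa> * (I + J) + (1 - \<kappa>) * A))"
      using vpos by (simp add: \<rho>_def)
    also have "N * f 0 - 2 * (\<rho> * (N * (I - J))) + \<rho> * (N * (\<kappa> * (I + J) + (1 - \<kappa>) * A)) =
        N * (f 0 - \<rho> * (2 * (I - J) - \<kappa> * (I + J) - (1 - \<kappa>) * A))"
      by (simp add: algebra_simps)
    finally have "\<rho> * (2 * (I - J) - \<kappa> * (I + J) - (1 - \<kappa>) * A) \<le> f 0"
      using N by (simp add: zero_le_mult_iff)
    moreover have "\<kappa> * (I + J) \<le> I + J" using \<kappa> Apos I by (intro mult_left_le_one_le) (auto simp: I_def)
    then have "\<rho> * (I - 3 * J - (1 - \<kappa>) * A) \<le> \<rho> * (2 * (I - J) - \<kappa> * (I + J) - (1 - \<kappa>) * A)"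
      using \<rho> by (intro mult_left_mono) auto
    ultimately have "\<rho> * (I - 3 * J - (1 - \<kappa>) * A) \<le> f 0" by linarith
    then have "N * (I - 3 * J - (1 - \<kappa>) * A) \<le> f 0 * v"
      using vpos by (simp add: \<rho>_def field_simps)
    then show ?thesis by (simp add: N_def I_def J_def A_def \<kappa>_def v)
  qed
qed

section \<open>Admissible functions\<close>

lemma integrable_if_decay:
  fixes g :: "real ^ 'n \<Rightarrow> 'b::{banach, second_countable_topology}"
  assumes "continuous_on UNIV g" "\<delta> > 0"
    and "\<And>x. norm (g x) \<le> C * (1 + norm x) powr (- real CARD('n) - \<delta>)"
  shows "integrable lborel g"
proof (rule Bochner_Integration.integrable_bound)
  show "integrable lborel (\<lambda>x :: real^'n. C * (1 + norm x) powr (- real CARD('n) - \<delta>))"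
    using integrable_one_plus_norm_powr[OF \<open>\<delta> > 0\<close>, where 'a = "real^'n"] by simp
  show "g \<in> borel_measurable lborel" using borel_measurable_continuous_onI[OF assms(1)] by simp
  show "AE x in lborel. norm (g x) \<le> norm (C * (1 + norm x) powr (- real CARD('n) - \<delta>))"
    using assms(3) by (intro AE_I2) (metis abs_ge_self order_trans real_norm_def)
qed

lemma
  fixes f :: "real ^ 'n \<Rightarrow> real"
  assumes "admissible f"
  shows admissible_continuous: "continuous_on UNIV f"
    and admissible_integrable: "integrable lborel f"
    and admissible_integrable_fourier: "integrable lborel (fourier f)"
    and admissible_bounded: "\<exists>C. \<forall>x. \<bar>f x\<bar> \<le> C"
proof -
  obtain \<delta> C where c: "continuous_on UNIV f" and d: "\<delta> > 0" "C > 0"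
    and b: "\<And>x. \<bar>f x\<bar> \<le> C * (1 + norm x) powr (- real CARD('n) - \<delta>)"
       "\<And>x. cmod (fourier f x) \<le> C * (1 + norm x) powr (- real CARD('n) - \<delta>)"
    using assms unfolding admissible_def by blast
  show "continuous_on UNIV f" by fact
  show f: "integrable lborel f"
    using b by (intro integrable_if_decay[OF c d(1), of C]) simp
  show "integrable lborel (fourier f)"
    using b by (intro integrable_if_decay[OF continuous_fourier[OF f] d(1), of C]) simp
  have "C * (1 + norm x) powr (- real CARD('n) - \<delta>) \<le> C * 1" for x :: "real^'n"
  proof (intro mult_left_mono)
    have "(1 + norm x) powr (- real CARD('n) - \<delta>) \<le> (1 + norm x) powr 0"
      using d by (intro powr_mono) auto
    moreover have "1 + norm x \<noteq> 0" using norm_ge_zero[of x] by linarith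
    ultimately show "(1 + norm x) powr (- real CARD('n) - \<delta>) \<le> 1" by simp
  qed (use d in simp)
  then show "\<exists>C. \<forall>x. \<bar>f x\<bar> \<le> C" using b(1) by (metis mult_1_right order_trans)
qed

lemma tail_integral_tendsto_0:
  fixes f :: "'a::euclidean_space \<Rightarrow> real"
  assumes f: "integrable lborel f"
  shows "(\<lambda>k. LINT z|lborel. indicator (- cball 0 (real (Suc k))) z * \<bar>f z\<bar>) \<longlonglongrightarrow> 0"
proof -
  have [measurable]: "f \<in> borel_measurable borel" using f by auto
  have "(\<lambda>k. LINT z|lborel. indicator (- cball 0 (real (Suc k))) z * \<bar>f z\<bar>) \<longlonglongrightarrow> (LINT z::'a|lborel. (0 :: real))"
  proof (rule integral_dominated_convergence[where w = "\<lambda>z. \<bar>f z\<bar>"])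
    show "AE z in lborel. (\<lambda>k. indicator (- cball 0 (real (Suc k))) z * \<bar>f z\<bar>) \<longlonglongrightarrow> 0"
    proof (rule AE_I2, rule tendsto_eventually)
      fix z :: 'a
      obtain k where "norm z \<le> real k" using real_arch_simple by blast
      then have "indicator (- cball 0 (real (Suc m))) z * \<bar>f z\<bar> = 0" if "m \<ge> k" for m
        using that by (auto simp: indicator_def)
      then show "\<forall>\<^sub>F m in sequentially. indicator (- cball 0 (real (Suc m))) z * \<bar>f z\<bar> = 0"
        by (auto simp: eventually_sequentially)
    qed
  qed (use f in \<open>auto simp: indicator_def\<close>)
  then show ?thesis by simp
qed

section \<open>Sphere packings\<close>

text \<open>
  Balls meeting only in their boundaries have centers at distance at least twice the radius.
\<close>
lemma sphere_packing_centers: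
  fixes P :: "(real ^ 'n) set set"
  assumes "sphere_packing P"
  obtains r C where "r > 0" "P = (\<lambda>c. cball c r) ` C"
    "\<And>c c'. c \<in> C \<Longrightarrow> c' \<in> C \<Longrightarrow> c \<noteq> c' \<Longrightarrow> dist c c' \<ge> 2 * r"
proof -
  obtain r where r: "r > 0" "\<And>B. B \<in> P \<Longrightarrow> \<exists>c. B = cball c r"
    and pw: "pairwise (\<lambda>A B. A \<inter> B \<subseteq> frontier A \<inter> frontier B) P"
    using assms unfolding sphere_packing_def by blast
  let ?C = "{c. cball c r \<in> P}"
  have "P = (\<lambda>c. cball c r) ` ?C" using r(2) by blast
  moreover have "dist c c' \<ge> 2 * r" if c: "c \<in> ?C" "c' \<in> ?C" "c \<noteq> c'" for c c'
  proof (rule ccontr)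
    assume less: "\<not> dist c c' \<ge> 2 * r"
    have "cball c r \<noteq> cball c' r" using c(3) r(1) by (simp add: cball_eq_cball_iff)
    then have "cball c r \<inter> cball c' r \<subseteq> frontier (cball c r) \<inter> frontier (cball c' r)"
      using pairwiseD[OF pw] c by blast
    moreover have "midpoint c c' \<in> cball c r \<inter> cball c' r"
      using less by (auto simp: dist_midpoint)
    ultimately have "midpoint c c' \<in> sphere c r" by auto
    then show False using less by (simp add: dist_midpoint)
  qed
  ultimately show thesis using that r(1) by blast
qed

lemma measure_packing_le:
  fixes C :: "'a::euclidean_space set"
  assumes fin: "finite (C \<inter> cball p (R + r))" and r: "r > 0"
  shows "measure lborel (cball p R \<inter> (\<Union>c\<in>C. cball c r)) \<le>
    real (card (C \<inter> cball p (R + r))) * (unit_ball_vol DIM('a) * r ^ DIM('a))"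
proof -
  let ?D = "C \<inter> cball p (R + r)"
  have sub: "cball p R \<inter> (\<Union>c\<in>C. cball c r) \<subseteq> (\<Union>c\<in>?D. cball c r)"
  proof
    fix x assume "x \<in> cball p R \<inter> (\<Union>c\<in>C. cball c r)"
    then obtain c where "c \<in> C" "dist c x \<le> r" "dist p x \<le> R" by auto
    moreover have "dist p c \<le> dist p x + dist c x" by (rule dist_triangle2)
    ultimately show "x \<in> (\<Union>c\<in>?D. cball c r)" by force
  qed
  \<comment> \<open>By \<open>fin\<close> only finitely many balls meet \<open>cball p R\<close>, which makes the intersection measurable.\<close>
  have eq: "cball p R \<inter> (\<Union>c\<in>C. cball c r) = cball p R \<inter> (\<Union>c\<in>?D. cball c r)"
    using sub by blast
  have fm: "cball c r \<in> fmeasurable lborel" for c :: 'a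
    using emeasure_lborel_cball_finite[of c r] by (intro fmeasurableI) auto
  have "measure lborel (cball p R \<inter> (\<Union>c\<in>C. cball c r)) \<le> measure lborel (\<Union>c\<in>?D. cball c r)"
    unfolding eq using fin
    by (intro measure_mono_fmeasurable fmeasurable.finite_UN fm) (auto intro!: borel_closed closed_UN)
  also have "\<dots> \<le> (\<Sum>c\<in>?D. measure lborel (cball c r))"
    by (rule measure_UNION_le[OF fin]) simp
  also have "\<dots> = real (card ?D) * (unit_ball_vol DIM('a) * r ^ DIM('a))"
    using r by (simp add: content_cball)
  finally show ?thesis .
qed

lemma finite_card_le_if_finite_subsets:
  assumes "\<And>X. X \<subseteq> S \<Longrightarrow> finite X \<Longrightarrow> real (card X) \<le> K"
  shows "finite S" "real (card S) \<le> K"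
proof -
  show "finite S"
  proof (rule ccontr)
    assume "infinite S"
    then obtain X where "X \<subseteq> S" "finite X" "card X = Suc (nat \<lceil>K\<rceil>)"
      using infinite_arbitrarily_large by metis
    with assms[of X] show False by linarith
  qed
  then show "real (card S) \<le> K" by (rule assms[OF order_refl])
qed

theorem theorem3p1:
  fixes f :: "real ^ 'n \<Rightarrow> real" and P :: "(real ^ 'n) set set"
  assumes "admissible f"
    and "f \<noteq> (\<lambda>x. 0)"
    and "\<And>x. norm x \<ge> 1 \<Longrightarrow> f x \<le> 0"
    and "\<And>t. fourier f t \<in> \<real>\<^sub>\<ge>\<^sub>0"
    and "sphere_packing P"
  shows "center_density P \<le>
    (if fourier f 0 = 0 then \<infinity>
     else ereal (f 0 / (2 ^ CARD('n) * Re (fourier f 0))))"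
proof (cases "fourier f 0 = 0")
  case True
  then show ?thesis by simp
next
  case False
  define n where "n = CARD('n)"
  define V where "V = unit_ball_vol (real n)"
  have V: "V > 0" by (simp add: V_def)
  define I A where "I = (LINT z|lborel. f z)" and "A = (LINT z|lborel. \<bar>f z\<bar>)"
  define J where "J L = (LINT z|lborel. indicator (- cball 0 L) z * \<bar>f z\<bar>)" for L
  note f = admissible_integrable[OF assms(1)]
  note fhat = admissible_integrable_fourier[OF assms(1)]
  obtain K where K: "\<And>x. \<bar>f x\<bar> \<le> K" using admissible_bounded[OF assms(1)] by blast
  have inv: "(LINT t|lborel. fourier f t * cnj (ech x t)) = f x" for x
    by (rule fourier_inversion[OF admissible_continuous[OF assms(1)] f K fhat])
  have f0: "fourier f 0 = of_real I" by (simp add: fourier_ech I_def)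
  have I: "I > 0" using assms(4)[of 0] False by (simp add: f0 nonneg_Reals_of_real_iff)
  obtain r C where r: "r > 0" and P: "P = (\<lambda>c. cball c r) ` C"
    and sep: "\<And>c c'. c \<in> C \<Longrightarrow> c' \<in> C \<Longrightarrow> c \<noteq> c' \<Longrightarrow> dist c c' \<ge> 2 * r"
    by (rule sphere_packing_centers[OF assms(5)], rule that)
  define T where "T R = (R + r) / (2 * r)" for R
  define D where "D R L = I - 3 * J L - (1 - (T R / (T R + L)) ^ n) * A" for R L
  define q where "q R L = V * f 0 * ((T R + L) * r / R) ^ n / D R L" for R L

  have count: "real (card X) * D R L \<le> f 0 * (V * (T R + L) ^ n)"
    if "R > 0" "L > 0" "finite X" "X \<subseteq> C \<inter> cball p (R + r)" for R L p X
  proof -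
    \<comment> \<open>Scaling by \<open>1 / (2 r)\<close> turns the centers into points at distance at least 1.\<close>
    let ?X = "(\<lambda>c. c /\<^sub>R (2 * r)) ` X"
    have scale: "dist (x /\<^sub>R (2 * r)) (y /\<^sub>R (2 * r)) = dist x y / (2 * r)" for x y :: "real^'n"
    proof -
      have "x /\<^sub>R (2 * r) - y /\<^sub>R (2 * r) = (x - y) /\<^sub>R (2 * r)"
        by (rule scaleR_diff_right[symmetric])
      then show ?thesis
        unfolding dist_norm using r by (simp only: norm_scaleR) (simp add: field_simps)
    qed
    have "card ?X = card X" using r by (intro card_image) (auto simp: inj_on_def)
    moreover have "real (card ?X) * D R L \<le> f 0 * (V * (T R + L) ^ n)"
    proof -
      have nonneg: "(LINT z|lborel. f z) \<ge> 0" using I by (simp add: I_def)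
      have fin: "finite ?X" using that by simp
      have sub: "?X \<subseteq> cball (p /\<^sub>R (2 * r)) (T R)"
        unfolding image_subset_iff mem_cball scale T_def
      proof
        fix x assume "x \<in> X"
        then have "dist p x \<le> R + r" using that(4) by auto
        then show "dist p x / (2 * r) \<le> (R + r) / (2 * r)" using r by (intro divide_right_mono) auto
      qed
      have sepX: "dist x y \<ge> 1" if xy: "x \<in> ?X" "y \<in> ?X" "x \<noteq> y" for x y
      proof -
        obtain c c' where c: "x = c /\<^sub>R (2 * r)" "y = c' /\<^sub>R (2 * r)" "c \<in> C" "c' \<in> C" "c \<noteq> c'"
          using xy \<open>X \<subseteq> C \<inter> cball p (R + r)\<close> by blast
        show ?thesis using sep[OF c(3-5)] r unfolding c(1,2) scale by simp
      qed
      have T: "T R > 0" using that r by (simp add: T_def)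
      from separated_card_bound[OF f assms(3) fhat assms(4) inv nonneg fin sub sepX T that(2)]
      show ?thesis
        unfolding D_def V_def I_def J_def A_def n_def by simp
    qed
    ultimately show ?thesis by simp
  qed
  have density: "ereal (measure lborel (cball p R \<inter> \<Union>P) / measure lborel (cball p R)) \<le> ereal (q R L)"
    if RL: "R > 0" "L > 0" and D: "D R L > 0" for R L p
  proof -
    let ?S = "C \<inter> cball p (R + r)"
    have "real (card X) \<le> f 0 * (V * (T R + L) ^ n) / D R L" if "X \<subseteq> ?S" "finite X" for X
      using count[OF RL that(2,1)] D by (simp add: pos_le_divide_eq)
    note S = finite_card_le_if_finite_subsets[of ?S, OF this]
    have "measure lborel (cball p R \<inter> \<Union>P) \<le> real (card ?S) * (V * r ^ n)"
      using measure_packing_le[OF S(1) r] by (simp add: P V_def n_def)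
    also have "\<dots> \<le> f 0 * (V * (T R + L) ^ n) / D R L * (V * r ^ n)"
      using S(2) V r by (intro mult_right_mono) auto
    finally have le: "measure lborel (cball p R \<inter> \<Union>P)
        \<le> f 0 * (V * (T R + L) ^ n) / D R L * (V * r ^ n)" .
    have vol: "measure lborel (cball p R) = V * R ^ n"
      using RL by (simp add: content_cball V_def n_def)
    have "measure lborel (cball p R \<inter> \<Union>P) / measure lborel (cball p R)
        \<le> f 0 * (V * (T R + L) ^ n) / D R L * (V * r ^ n) / (V * R ^ n)"
      unfolding vol using le RL V by (intro divide_right_mono) auto
    also have "\<dots> = q R L"
      using V by (simp add: q_def power_divide power_mult_distrib mult_ac)
    finally show ?thesis by simp
  qed
  \<comment> \<open>The limit in the radius \<open>R\<close> at fixed \<open>L\<close>; afterwards \<open>L\<close> tends to infinity.\<close>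
  have upper: "upper_density P \<le> ereal (V * f 0 * (1 / 2) ^ n / (I - 3 * J L))"
    if L: "L > 0" and pos: "I - 3 * J L > 0" for L
  proof -
    have "((\<lambda>R. T R / (T R + L)) \<longlongrightarrow> 1) at_top" "((\<lambda>R. (T R + L) * r / R) \<longlongrightarrow> 1 / 2) at_top"
      unfolding T_def using r L by real_asymp+
    note lims = this
    have "((\<lambda>R. D R L) \<longlongrightarrow> I - 3 * J L - (1 - 1 ^ n) * A) at_top"
      unfolding D_def by (intro tendsto_intros lims)
    then have Dlim: "((\<lambda>R. D R L) \<longlongrightarrow> I - 3 * J L) at_top" by simp
    have "((\<lambda>R. q R L) \<longlongrightarrow> V * f 0 * (1 / 2) ^ n / (I - 3 * J L)) at_top"
      unfolding q_def using pos by (intro tendsto_intros lims Dlim) auto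
    then have qlim: "((\<lambda>R. ereal (q R L)) \<longlongrightarrow> ereal (V * f 0 * (1 / 2) ^ n / (I - 3 * J L))) at_top"
      by simp
    have "\<forall>\<^sub>F R in at_top. (SUP p. ereal (measure lborel (cball p R \<inter> \<Union>P) / measure lborel (cball p R))) \<le> ereal (q R L)"
      using order_tendstoD(1)[OF Dlim pos] eventually_gt_at_top[of 0]
      by eventually_elim (intro SUP_least density L)
    then have "upper_density P \<le> Limsup at_top (\<lambda>R. ereal (q R L))"
      unfolding upper_density_def by (rule Limsup_mono)
    also have "\<dots> = ereal (V * f 0 * (1 / 2) ^ n / (I - 3 * J L))"
      using qlim by (intro lim_imp_Limsup) auto
    finally show ?thesis .
  qed
  have J0: "(\<lambda>k. J (real (Suc k))) \<longlonglongrightarrow> 0"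
    unfolding J_def by (rule tail_integral_tendsto_0[OF f])
  have "(\<lambda>k. I - 3 * J (real (Suc k))) \<longlonglongrightarrow> I - 3 * 0"
    by (intro tendsto_intros J0)
  then have lim: "(\<lambda>k. I - 3 * J (real (Suc k))) \<longlonglongrightarrow> I" by simp
  then have "(\<lambda>k. V * f 0 * (1 / 2) ^ n / (I - 3 * J (real (Suc k)))) \<longlonglongrightarrow> V * f 0 * (1 / 2) ^ n / I"
    using I by (intro tendsto_intros) auto
  then have "(\<lambda>k. ereal (V * f 0 * (1 / 2) ^ n / (I - 3 * J (real (Suc k))))) \<longlonglongrightarrow> ereal (V * f 0 * (1 / 2) ^ n / I)"
    by simp
  moreover have "\<exists>N. \<forall>k\<ge>N. upper_density P \<le> ereal (V * f 0 * (1 / 2) ^ n / (I - 3 * J (real (Suc k))))"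
    unfolding eventually_sequentially[symmetric] using order_tendstoD(1)[OF lim I]
    by eventually_elim (rule upper, simp_all)
  ultimately have "upper_density P \<le> ereal (V * f 0 * (1 / 2) ^ n / I)"
    by (rule LIMSEQ_le_const)
  then have "upper_density P / ereal V \<le> ereal (V * f 0 * (1 / 2) ^ n / I) / ereal V"
    using V by (intro ereal_divide_right_mono) auto
  also have "\<dots> = ereal (f 0 / (2 ^ n * I))"
    using V by (simp add: power_one_over field_simps)
  finally show ?thesis
    using False by (simp add: center_density_def V_def n_def unit_ball_vol_def f0)
qed

end
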